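(* Let $t\in[k]$ be a fixed constant and let $$S_1^t:=\Big\{\frac1t\sum_{r\in[t]}\bm{y}_r:\ T_r\in[k],\ \bm{y}_r\in\Xi_{T_r},\ r\in[t]\Big\}.$$ Then $$v(S_1^t)\le\Big(1+\frac1t\Big)v^*,$$ and the support size satisfies $|S_1^t|=O((nk)^t)$.
   Context: Notation: $[k]=\{1,\dots,k\}$. For $i\in[k]$, $\mathbb{P}_i=\sum_{j\in[|\Xi_i|]}\hat p_{ij}\delta_{\hat{\bm{x}}_{ij}}$ is a probability measure supported on a nonempty finite set $\Xi_i=\{\hat{\bm{x}}_{ij}\}_j\subseteq\mathbb{R}^d$ with $|\Xi_i|\le n$. Weights $\bm\lambda=(\lambda_1,\dots,\lambda_k)$ satisfy $\lambda_i\ge0$ and $\sum_{i\in[k]}\lambda_i=1$. The barycenter value is $v^*=\inf_{\mathbb{P}}\sum_{i\in[k]}\lambda_iW_2^2(\mathbb{P},\mathbb{P}_i)$, the infimum over Borel probability measures on $\mathbb{R}^d$ with finite second moment, where $W_2$ is the type-2 Wasserstein distance for the Euclidean norm. For a nonempty finite set $S\subseteq\mathbb{R}^d$ and $\vec{\bm{j}}=(j_1,\dots,j_k)$ with $j_i\in[|\Xi_i|]$, put $C_{\vec{\bm{j}}}(S)=\min_{\bm{w}\in S}\sum_{i\in[k]}\lambda_i\|\hat{\bm{x}}_{i,j_i}-\bm{w}\|_2^2$, and define $$v(S)=\max_{\bm\gamma}\Big\{\sum_{i\in[k]}\sum_{j\in[|\Xi_i|]}\hat p_{ij}\gamma_{ij}:\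 C_{\vec{\bm{j}}}(S)-\sum_{i\in[k]}\gamma_{ij_i}\ge0\ \ \forall\,\vec{\bm{j}}\in\prod_{i\in[k]}[|\Xi_i|]\Big\}.$$ This is the linear-programming dual of (and has the same value as) the problem of minimizing $\sum_{\vec{\bm{j}}}C_{\vec{\bm{j}}}(S)\Pi_{\vec{\bm{j}}}$ over nonnegative tensors $\bm\Pi$ whose $i$-th marginal is $(\hat p_{ij})_j$ for every $i\in[k]$. Since $t$ is a fixed constant, the constant in $O(\cdot)$ may depend on $t$ only. *)

theory Defs
  imports "HOL-Probability.Probability"
begin

text \<open>
  The space \<open>\<real>\<^sup>d\<close> is modelled with the dimension as a term-level natural number, because the
  constant in the size bound has to be chosen before \<open>d\<close>.  Its points are the functions in
  \<open>{1..d} \<rightarrow>\<^sub>E UNIV\<close>, and the finite product of Borel algebras is the Borel algebra of \<open>\<real>\<^sup>d\<close>.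
\<close>

definition Rd :: "nat \<Rightarrow> (nat \<Rightarrow> real) measure" where
  "Rd d = (\<Pi>\<^sub>M c\<in>{1..d}. borel)"

definition edist :: "nat \<Rightarrow> (nat \<Rightarrow> real) \<Rightarrow> (nat \<Rightarrow> real) \<Rightarrow> real" where
  "edist d x y = L2_set (\<lambda>c. x c - y c) {1..d}"

definition P2 :: "nat \<Rightarrow> (nat \<Rightarrow> real) measure set" where
  "P2 d = {P. prob_space P \<and> sets P = sets (Rd d) \<and> integrable P (\<lambda>x. (L2_set x {1..d})\<^sup>2)}"

definition couplings :: "'a measure \<Rightarrow> 'b measure \<Rightarrow> ('a \<times> 'b) measure set" where
  "couplings P Q = {\<pi>. prob_space \<pi> \<and> sets \<pi> = sets (P \<Otimes>\<^sub>M Q) \<and>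
                       distr \<pi> P fst = P \<and> distr \<pi> Q snd = Q}"

text \<open>
  For arguments in \<open>P2 d\<close> the infimum below is finite (the product measure is a coupling of finite
  cost), so that the conversion from \<open>ennreal\<close> to \<open>real\<close> loses nothing.
\<close>

definition W2 :: "nat \<Rightarrow> (nat \<Rightarrow> real) measure \<Rightarrow> (nat \<Rightarrow> real) measure \<Rightarrow> real" where
  "W2 d P Q =
     sqrt (enn2real (INF \<pi>\<in>couplings P Q. \<integral>\<^sup>+ z. ennreal ((edist d (fst z) (snd z))\<^sup>2) \<partial>\<pi>))"

definition discrete_measure ::
    "nat \<Rightarrow> nat \<Rightarrow> (nat \<Rightarrow> real) \<Rightarrow> (nat \<Rightarrow> nat \<Rightarrow> real) \<Rightarrow> (nat \<Rightarrow> real) measure" where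
  "discrete_measure d m p x =
     measure_of (space (Rd d)) (sets (Rd d))
       (\<lambda>A. \<Sum>j\<in>{1..m}. ennreal (p j) * emeasure (return (Rd d) (x j)) A)"

text \<open>
  Below, \<open>m i\<close> is the number of atoms of the \<open>i\<close>-th measure, \<open>x i j\<close> and \<open>p i j\<close> (for \<open>j\<close> in
  \<open>{1..m i}\<close>) are its atoms and their masses, and \<open>l i\<close> is its weight.
\<close>

definition barycenter_value ::
    "nat \<Rightarrow> nat \<Rightarrow> (nat \<Rightarrow> nat) \<Rightarrow> (nat \<Rightarrow> nat \<Rightarrow> nat \<Rightarrow> real) \<Rightarrow> (nat \<Rightarrow> nat \<Rightarrow> real) \<Rightarrow>
      (nat \<Rightarrow> real) \<Rightarrow> real" where
  "barycenter_value d k m x p l =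
     (INF P\<in>P2 d. \<Sum>i\<in>{1..k}. l i * (W2 d P (discrete_measure d (m i) (p i) (x i)))\<^sup>2)"

definition tensor_cost ::
    "nat \<Rightarrow> nat \<Rightarrow> (nat \<Rightarrow> nat \<Rightarrow> nat \<Rightarrow> real) \<Rightarrow> (nat \<Rightarrow> real) \<Rightarrow> (nat \<Rightarrow> real) set \<Rightarrow>
      (nat \<Rightarrow> nat) \<Rightarrow> real" where
  "tensor_cost d k x l S j = Min ((\<lambda>w. \<Sum>i\<in>{1..k}. l i * (edist d (x i (j i)) w)\<^sup>2) ` S)"

text \<open>
  The optimal value of a linear program that is feasible (take a constant, sufficiently negative
  \<open>\<gamma>\<close>) and bounded (by weak duality); its maximum is therefore the supremum.
\<close>

definition dual_value ::
    "nat \<Rightarrow> nat \<Rightarrow> (nat \<Rightarrow> nat) \<Rightarrow> (nat \<Rightarrow> nat \<Rightarrow> nat \<Rightarrow> real) \<Rightarrow> (nat \<Rightarrow> nat \<Rightarrow> real) \<Rightarrow>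
      (nat \<Rightarrow> real) \<Rightarrow> (nat \<Rightarrow> real) set \<Rightarrow> real" where
  "dual_value d k m x p l S =
     Sup {(\<Sum>i\<in>{1..k}. \<Sum>j\<in>{1..m i}. p i j * \<gamma> i j) | \<gamma>.
           \<forall>j \<in> (\<Pi>\<^sub>E i\<in>{1..k}. {1..m i}).
             tensor_cost d k x l S j - (\<Sum>i\<in>{1..k}. \<gamma> i (j i)) \<ge> 0}"

definition support_average_set ::
    "nat \<Rightarrow> nat \<Rightarrow> nat \<Rightarrow> (nat \<Rightarrow> (nat \<Rightarrow> real) set) \<Rightarrow> (nat \<Rightarrow> real) set" where
  "support_average_set t d k \<Xi> =
     {(\<lambda>c\<in>{1..d}. (1 / real t) * (\<Sum>r\<in>{1..t}. y r c)) | (T :: nat \<Rightarrow> nat) y.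
        \<forall>r\<in>{1..t}. T r \<in> {1..k} \<and> y r \<in> \<Xi> (T r)}"

end

theory Submission imports Defs begin

text \<open>
  Write \<open>\<mu>\<close> for the weighted mean of points \<open>x\<^sub>1, \<dots>, x\<^sub>k\<close> and \<open>V\<close> for their weighted variance.
  Averaging over the index shows that some \<open>i\<close> satisfies
  \<open>\<parallel>A + (x\<^sub>i - \<mu>)\<parallel>\<^sup>2 \<le> \<parallel>A\<parallel>\<^sup>2 + V\<close>; hence \<open>t\<close> points can be chosen one after the other such that
  their average has squared distance at most \<open>V / t\<close> from \<open>\<mu>\<close>.  So the cost over \<open>S\<close> of any
  tuple is at most \<open>1 + 1/t\<close> times the cost of the tuple at an arbitrary point \<open>w\<close>.

  Weak duality then needs no gluing of couplings: for a feasible \<open>\<gamma>\<close> the functions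
  \<open>\<phi>\<^sub>i(w) = max\<^sub>j (\<gamma>\<^sub>i\<^sub>j - (1 + 1/t) \<lambda>\<^sub>i \<parallel>x\<^sub>i\<^sub>j - w\<parallel>\<^sup>2)\<close> have nonpositive sum, and integrating
  \<open>\<gamma>\<^sub>i\<^sub>j \<le> \<phi>\<^sub>i(w) + (1 + 1/t) \<lambda>\<^sub>i \<parallel>x\<^sub>i\<^sub>j - w\<parallel>\<^sup>2\<close> against a nearly optimal coupling of \<open>P\<close> and \<open>P\<^sub>i\<close>
  and summing over \<open>i\<close> gives the bound for every competitor \<open>P\<close>.
\<close>

section \<open>Squared Euclidean distances in coordinates\<close>

lemma edist_square: "(edist d x y)\<^sup>2 = (\<Sum>c\<in>{1..d}. (x c - y c)\<^sup>2)"
  unfolding edist_def L2_set_def by (simp add: sum_nonneg)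

lemma L2_set_square: "(L2_set x A)\<^sup>2 = (\<Sum>c\<in>A. (x c)\<^sup>2)"
  unfolding L2_set_def by (simp add: sum_nonneg)

lemma edist_square_le: "(edist d x y)\<^sup>2 \<le> 2 * (L2_set x {1..d})\<^sup>2 + 2 * (L2_set y {1..d})\<^sup>2"
proof -
  have "(a - b)\<^sup>2 \<le> 2 * a\<^sup>2 + 2 * b\<^sup>2" for a b :: real
    using zero_le_power2[of "a + b"] by (simp add: power2_eq_square algebra_simps)
  then show ?thesis
    unfolding edist_square L2_set_square
    by (simp add: sum_distrib_left flip: sum.distrib) (rule sum_mono, simp)
qed

subsection \<open>Averages of few points\<close>

text \<open>If every value exceeded the average, so would the average itself. Some weight is
  positive because the weights sum to 1, and that index makes the contradiction strict.\<close>

lemma exists_le_weighted_average: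
  fixes l f :: "'i \<Rightarrow> real"
  assumes "finite I" "\<And>i. i \<in> I \<Longrightarrow> l i \<ge> 0" "sum l I = 1"
  shows "\<exists>i\<in>I. f i \<le> (\<Sum>i\<in>I. l i * f i)"
proof (rule ccontr)
  assume "\<not> ?thesis"
  then have less: "(\<Sum>i\<in>I. l i * f i) < f i" if "i \<in> I" for i
    using that by auto
  define a where "a = (\<Sum>i\<in>I. l i * f i)"
  obtain i where i: "i \<in> I" "l i > 0"
    using assms by (metis less_eq_real_def sum.neutral zero_neq_one)
  have "(\<Sum>i\<in>I. l i * a) < (\<Sum>i\<in>I. l i * f i)"
  proof (rule sum_strict_mono_ex1[OF assms(1)])
    show "\<forall>i\<in>I. l i * a \<le> l i * f i"
      using assms(2) less by (simp add: a_def mult_left_mono less_imp_le)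
    show "\<exists>i\<in>I. l i * a < l i * f i"
      using i less by (auto simp: a_def intro!: bexI[of _ i])
  qed
  then show False
    using assms(3) by (simp add: a_def flip: sum_distrib_right)
qed

text \<open>The cross term \<open>2 * a * l i * u i\<close> cancels because the \<open>u i\<close>
  are centred. This gives both the greedy selection step and the split of a cost into squared
  distance from the mean plus variance.\<close>

lemma weighted_sum_square_add:
  fixes l u :: "'i \<Rightarrow> real"
  assumes "sum l I = 1" "(\<Sum>i\<in>I. l i * u i) = 0"
  shows "(\<Sum>i\<in>I. l i * (a + u i)\<^sup>2) = a\<^sup>2 + (\<Sum>i\<in>I. l i * (u i)\<^sup>2)"
proof -
  have "l i * (a + u i)\<^sup>2 = a\<^sup>2 * l i + 2 * a * (l i * u i) + l i * (u i)\<^sup>2" for i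
    by (simp add: power2_eq_square algebra_simps)
  then have "(\<Sum>i\<in>I. l i * (a + u i)\<^sup>2)
      = a\<^sup>2 * sum l I + 2 * a * (\<Sum>i\<in>I. l i * u i) + (\<Sum>i\<in>I. l i * (u i)\<^sup>2)"
    by (simp add: sum.distrib flip: sum_distrib_left)
  then show ?thesis
    using assms by simp
qed

text \<open>A derandomised form of independent sampling from \<open>l\<close>. A random further
  index adds, on average, exactly the variance to the squared norm of the sum, so some index adds no
  more. Indices may repeat.\<close>

lemma exists_small_sum:
  fixes u :: "'i \<Rightarrow> 'c \<Rightarrow> real"
  assumes "finite I" "\<And>i. i \<in> I \<Longrightarrow> l i \<ge> 0" "sum l I = 1"
    and "\<And>c. c \<in> D \<Longrightarrow> (\<Sum>i\<in>I. l i * u i c) = 0"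
  shows "\<exists>T. (\<forall>r\<in>{1..t::nat}. T r \<in> I) \<and>
    (\<Sum>c\<in>D. (\<Sum>r\<in>{1..t}. u (T r) c)\<^sup>2) \<le> real t * (\<Sum>i\<in>I. l i * (\<Sum>c\<in>D. (u i c)\<^sup>2))"
    (is "\<exists>T. ?P t T")
proof (induction t)
  case 0
  show ?case by simp
next
  case (Suc t)
  let ?V = "\<Sum>i\<in>I. l i * (\<Sum>c\<in>D. (u i c)\<^sup>2)"
  from Suc obtain T where T: "?P t T" by blast
  define A where "A c = (\<Sum>r\<in>{1..t}. u (T r) c)" for c
  \<comment> \<open>Swapping the sums lets the one-dimensional identity apply in each coordinate,
    with \<open>A c\<close> as the fixed part.\<close>
  have "(\<Sum>i\<in>I. l i * (\<Sum>c\<in>D. (A c + u i c)\<^sup>2)) = (\<Sum>c\<in>D. \<Sum>i\<in>I. l i * (A c + u i c)\<^sup>2)"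
    by (simp add: sum_distrib_left) (rule sum.swap)
  also have "\<dots> = (\<Sum>c\<in>D. (A c)\<^sup>2 + (\<Sum>i\<in>I. l i * (u i c)\<^sup>2))"
    using assms by (intro sum.cong refl weighted_sum_square_add) auto
  also have "\<dots> = (\<Sum>c\<in>D. (A c)\<^sup>2) + ?V"
    by (simp add: sum.distrib sum_distrib_left) (rule sum.swap)
  finally obtain i where i: "i \<in> I" "(\<Sum>c\<in>D. (A c + u i c)\<^sup>2) \<le> (\<Sum>c\<in>D. (A c)\<^sup>2) + ?V"
    using exists_le_weighted_average[OF assms(1-3), of "\<lambda>i. \<Sum>c\<in>D. (A c + u i c)\<^sup>2"] by auto
  define T' where "T' = T(Suc t := i)"
  have "(\<Sum>r\<in>{1..Suc t}. u (T' r) c) = A c + u i c" for c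
    unfolding A_def T'_def by (simp add: sum.cl_ivl_Suc)
  moreover have "(\<Sum>c\<in>D. (A c)\<^sup>2) \<le> real t * ?V"
    using T unfolding A_def by simp
  ultimately have "?P (Suc t) T'"
    using i T by (auto simp: T'_def algebra_simps)
  then show ?case by blast
qed

text \<open>The cost at a point is \<open>V\<close> plus its squared distance from the mean. The
  chosen average costs at most \<open>V / t + V\<close>, while any \<open>w\<close> costs at least
  \<open>V\<close>.\<close>

lemma exists_good_average:
  fixes y :: "'i \<Rightarrow> nat \<Rightarrow> real"
  assumes "finite I" "\<And>i. i \<in> I \<Longrightarrow> l i \<ge> 0" "sum l I = 1" "t \<ge> 1"
  shows "\<exists>T. (\<forall>r\<in>{1..t::nat}. T r \<in> I) \<and>
    (\<Sum>i\<in>I. l i * (edist d (y i) (\<lambda>c\<in>{1..d}. 1 / real t * (\<Sum>r\<in>{1..t}. y (T r) c)))\<^sup>2)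
      \<le> (1 + 1 / real t) * (\<Sum>i\<in>I. l i * (edist d (y i) w)\<^sup>2)"
proof -
  define \<mu> where "\<mu> c = (\<Sum>i\<in>I. l i * y i c)" for c
  define u where "u i c = y i c - \<mu> c" for i c
  define V where "V = (\<Sum>i\<in>I. l i * (\<Sum>c\<in>{1..d}. (u i c)\<^sup>2))"
  have u0: "(\<Sum>i\<in>I. l i * u i c) = 0" for c
    using assms(3) by (simp add: u_def right_diff_distrib sum_subtractf \<mu>_def flip: sum_distrib_right)
  have shift: "(\<Sum>i\<in>I. l i * (edist d (y i) z)\<^sup>2) = (\<Sum>c\<in>{1..d}. (\<mu> c - z c)\<^sup>2) + V" for z
  proof -
    have "(\<Sum>i\<in>I. l i * (edist d (y i) z)\<^sup>2)
        = (\<Sum>c\<in>{1..d}. \<Sum>i\<in>I. l i * ((\<mu> c - z c) + u i c)\<^sup>2)"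
      by (simp add: edist_square sum_distrib_left u_def) (rule sum.swap)
    also have "\<dots> = (\<Sum>c\<in>{1..d}. (\<mu> c - z c)\<^sup>2 + (\<Sum>i\<in>I. l i * (u i c)\<^sup>2))"
      using assms u0 by (intro sum.cong refl weighted_sum_square_add) auto
    also have "\<dots> = (\<Sum>c\<in>{1..d}. (\<mu> c - z c)\<^sup>2) + V"
      unfolding V_def by (simp add: sum.distrib sum_distrib_left) (rule sum.swap)
    finally show ?thesis .
  qed
  obtain T where T: "\<forall>r\<in>{1..t}. T r \<in> I"
      "(\<Sum>c\<in>{1..d}. (\<Sum>r\<in>{1..t}. u (T r) c)\<^sup>2) \<le> real t * V"
    using exists_small_sum[OF assms(1-3), where u = u and D = "{1..d}" and t = t] u0
    unfolding V_def by blast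
  let ?z = "\<lambda>c\<in>{1..d}. 1 / real t * (\<Sum>r\<in>{1..t}. y (T r) c)"
  have "(\<mu> c - ?z c)\<^sup>2 = (\<Sum>r\<in>{1..t}. u (T r) c)\<^sup>2 / (real t)\<^sup>2" if "c \<in> {1..d}" for c
  proof -
    \<comment> \<open>The \<open>t\<close> copies of the mean inside the sum of the
      \<open>u (T r) c\<close> average back to \<open>\<mu> c\<close>; the sign disappears on
      squaring.\<close>
    have "\<mu> c - ?z c = - ((\<Sum>r\<in>{1..t}. u (T r) c) / real t)"
      using assms(4) that by (simp add: u_def sum_subtractf field_simps)
    then show ?thesis
      by (simp add: power_divide)
  qed
  then have "(\<Sum>c\<in>{1..d}. (\<mu> c - ?z c)\<^sup>2) = (\<Sum>c\<in>{1..d}. (\<Sum>r\<in>{1..t}. u (T r) c)\<^sup>2) / (real t)\<^sup>2"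
    by (simp add: sum_divide_distrib)
  also have "\<dots> \<le> real t * V / (real t)\<^sup>2"
    using T(2) by (intro divide_right_mono) auto
  also have "\<dots> = 1 / real t * V"
    using assms(4) by (simp add: power2_eq_square)
  finally have "(\<Sum>i\<in>I. l i * (edist d (y i) ?z)\<^sup>2) \<le> (1 + 1 / real t) * V"
    unfolding shift by (simp add: algebra_simps)
  also have "\<dots> \<le> (1 + 1 / real t) * (\<Sum>i\<in>I. l i * (edist d (y i) w)\<^sup>2)"
    unfolding shift by (intro mult_left_mono) (auto intro: sum_nonneg)
  finally show ?thesis
    using T(1) by blast
qed

section \<open>The set of averages: its size and the tensor cost over it\<close>

lemma support_average_set_finite_card:
  assumes "\<And>i. i \<in> {1..k} \<Longrightarrow> finite (\<Xi> i) \<and> card (\<Xi> i) \<le> n"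
  shows "finite (support_average_set t d k \<Xi>) \<and> card (support_average_set t d k \<Xi>) \<le> (n * k) ^ t"
proof -
  let ?U = "\<Union>i\<in>{1..k}. \<Xi> i"
  let ?F = "\<lambda>y. \<lambda>c\<in>{1..d}. 1 / real t * (\<Sum>r\<in>{1..t}. y r c)"
  \<comment> \<open>The indices \<open>T\<close> are forgotten: an average depends only on its
    \<open>t\<close> points, each from the union of the supports, which has at most
    \<open>n * k\<close> elements.\<close>
  have sub: "support_average_set t d k \<Xi> \<subseteq> ?F ` (\<Pi>\<^sub>E r\<in>{1..t}. ?U)"
  proof
    fix s assume "s \<in> support_average_set t d k \<Xi>"
    then obtain T y where s: "s = ?F y" and y: "\<forall>r\<in>{1..t}. T r \<in> {1..k} \<and> y r \<in> \<Xi> (T r)"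
      unfolding support_average_set_def by blast
    have "y r \<in> ?U" if "r \<in> {1..t}" for r
      using y that by blast
    then have "restrict y {1..t} \<in> (\<Pi>\<^sub>E r\<in>{1..t}. ?U)"
      by (simp add: restrict_PiE_iff)
    moreover have "s = ?F (restrict y {1..t})"
      unfolding s by (intro restrict_ext) simp
    ultimately show "s \<in> ?F ` (\<Pi>\<^sub>E r\<in>{1..t}. ?U)" by blast
  qed
  have fin: "finite (\<Pi>\<^sub>E r\<in>{1..t}. ?U)"
    using assms by (intro finite_PiE) auto
  have "card ?U \<le> (\<Sum>i\<in>{1..k}. card (\<Xi> i))"
    by (rule card_UN_le) simp
  also have "\<dots> \<le> n * k"
    using sum_bounded_above[of "{1..k}" "\<lambda>i. card (\<Xi> i)" n] assms by (simp add: mult.commute)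
  finally have U: "card ?U \<le> n * k" .
  have "card (support_average_set t d k \<Xi>) \<le> card (\<Pi>\<^sub>E r\<in>{1..t}. ?U)"
    using surj_card_le[OF fin sub] .
  also have "\<dots> = card ?U ^ t"
    by (simp add: card_PiE)
  also have "\<dots> \<le> (n * k) ^ t"
    using U by (rule power_mono) simp
  finally show ?thesis
    using finite_subset[OF sub] fin by blast
qed

text \<open>The good average for the tuple is built from the tuple's own points, so it belongs to
  the set over which the cost is minimised.\<close>

lemma tensor_cost_support_average_le:
  assumes "\<And>i. i \<in> {1..k} \<Longrightarrow> l i \<ge> 0" "(\<Sum>i\<in>{1..k}. l i) = 1" "t \<ge> 1"
    and "finite (support_average_set t d k \<Xi>)" "\<And>i. i \<in> {1..k} \<Longrightarrow> x i (j i) \<in> \<Xi> i"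
  shows "tensor_cost d k x l (support_average_set t d k \<Xi>) j
    \<le> (1 + 1 / real t) * (\<Sum>i\<in>{1..k}. l i * (edist d (x i (j i)) w)\<^sup>2)"
proof -
  obtain T where T: "\<forall>r\<in>{1..t}. T r \<in> {1..k}"
    and le: "(\<Sum>i\<in>{1..k}. l i * (edist d (x i (j i))
          (\<lambda>c\<in>{1..d}. 1 / real t * (\<Sum>r\<in>{1..t}. x (T r) (j (T r)) c)))\<^sup>2)
      \<le> (1 + 1 / real t) * (\<Sum>i\<in>{1..k}. l i * (edist d (x i (j i)) w)\<^sup>2)"
    using exists_good_average[of "{1..k}" l t d "\<lambda>i. x i (j i)" w] assms by auto
  have "(\<lambda>c\<in>{1..d}. 1 / real t * (\<Sum>r\<in>{1..t}. x (T r) (j (T r)) c)) \<in> support_average_set t d k \<Xi>"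
    unfolding support_average_set_def mem_Collect_eq using T assms(5)
    by (intro exI[of _ T] exI[of _ "\<lambda>r. x (T r) (j (T r))"]) auto
  then have "tensor_cost d k x l (support_average_set t d k \<Xi>) j
      \<le> (\<Sum>i\<in>{1..k}. l i * (edist d (x i (j i))
          (\<lambda>c\<in>{1..d}. 1 / real t * (\<Sum>r\<in>{1..t}. x (T r) (j (T r)) c)))\<^sup>2)"
    unfolding tensor_cost_def using assms(4) by (intro Min_le) auto
  then show ?thesis
    using le by simp
qed

subsection \<open>Integration against couplings\<close>

lemma space_Rd: "space (Rd d) = (\<Pi>\<^sub>E c\<in>{1..d}. UNIV)"
  unfolding Rd_def by (simp add: space_PiM)

lemma edist_measurable [measurable]:
  "(\<lambda>z. edist d (f z) (g z)) \<in> borel_measurable M"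
  if [measurable]: "f \<in> measurable M (Rd d)" "g \<in> measurable M (Rd d)"
proof -
  have [measurable]: "(\<lambda>z. f z c) \<in> borel_measurable M" "(\<lambda>z. g z c) \<in> borel_measurable M"
    if "c \<in> {1..d}" for c
    using measurable_compose[OF \<open>f \<in> _\<close>[unfolded Rd_def] measurable_component_singleton[OF that]]
      measurable_compose[OF \<open>g \<in> _\<close>[unfolded Rd_def] measurable_component_singleton[OF that]]
    by auto
  show ?thesis
    unfolding edist_def L2_set_def by measurable
qed

lemma L2_set_measurable [measurable]: "(\<lambda>x. L2_set x {1..d}) \<in> borel_measurable (Rd d)"
proof -
  have [measurable]: "(\<lambda>z. z c) \<in> borel_measurable (Rd d)" if "c \<in> {1..d}" for c
    unfolding Rd_def using measurable_component_singleton[OF that] by auto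
  show ?thesis
    unfolding L2_set_def by measurable
qed

section \<open>Finitely supported measures as pushforwards of point measures\<close>

lemma discrete_measure_eq_distr:
  assumes "x ` {1..m} \<subseteq> space (Rd d)"
  shows "discrete_measure d m p x = distr (point_measure {1..m} (\<lambda>j. ennreal (p j))) (Rd d) x"
    (is "_ = ?D")
proof -
  have x: "x \<in> measurable (point_measure {1..m} (\<lambda>j. ennreal (p j))) (Rd d)"
    using assms by (auto simp: measurable_point_measure_eq1)
  have "(\<Sum>j\<in>{1..m}. ennreal (p j) * emeasure (return (Rd d) (x j)) A) = emeasure ?D A"
    if A: "A \<in> sets (Rd d)" for A
  proof -
    have "emeasure ?D A = (\<Sum>j\<in>{1..m} \<inter> x -` A. ennreal (p j))"
      using A x by (simp add: emeasure_distr space_point_measure emeasure_point_measure_finite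
          Int_commute)
    also have "\<dots> = (\<Sum>j\<in>{1..m}. ennreal (p j) * indicator A (x j))"
      by (auto simp: sum.inter_restrict indicator_def intro!: sum.cong)
    finally show ?thesis
      using A by simp
  qed
  then have "discrete_measure d m p x = measure_of (space (Rd d)) (sets (Rd d)) (emeasure ?D)"
    unfolding discrete_measure_def
    by (intro measure_of_eq) (auto simp: sets.space_closed sets.sigma_sets_eq)
  also have "\<dots> = ?D"
    using measure_of_of_measure[of ?D] by simp
  finally show ?thesis .
qed

text \<open>All three facts are pulled back along \<open>x\<close> to the point measure on the
  indices, where integrals are finite sums and every function is integrable.\<close>

lemma
  assumes x: "x ` {1..m} \<subseteq> space (Rd d)"
    and p: "\<And>j. j \<in> {1..m} \<Longrightarrow> p j \<ge> 0" "(\<Sum>j\<in>{1..m}. p j) = 1"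
  shows discrete_measure_in_P2: "discrete_measure d m p x \<in> P2 d"
    and integral_discrete_measure:
      "f \<in> borel_measurable (Rd d) \<Longrightarrow>
        integral\<^sup>L (discrete_measure d m p x) f = (\<Sum>j\<in>{1..m}. p j * f (x j))"
    and AE_discrete_measure:
      "{z \<in> space (Rd d). Q z} \<in> sets (Rd d) \<Longrightarrow> (\<And>j. j \<in> {1..m} \<Longrightarrow> Q (x j)) \<Longrightarrow>
        AE z in discrete_measure d m p x. Q z"
proof -
  let ?M = "point_measure {1..m} (\<lambda>j. ennreal (p j))"
  have xM: "x \<in> measurable ?M (Rd d)"
    using x by (auto simp: measurable_point_measure_eq1)
  have "prob_space ?M"
  proof (rule prob_space_point_measure)
    show "(\<Sum>j\<in>{1..m}. ennreal (p j)) = 1"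
      using p by (subst sum_ennreal) auto
  qed auto
  moreover have "(\<lambda>z. (L2_set z {1..d})\<^sup>2) \<in> borel_measurable (Rd d)"
    by measurable
  then have "integrable (distr ?M (Rd d) x) (\<lambda>z. (L2_set z {1..d})\<^sup>2)"
    by (subst integrable_distr_eq[OF xM]) (auto intro: integrable_point_measure_finite)
  ultimately show "discrete_measure d m p x \<in> P2 d"
    using xM unfolding discrete_measure_eq_distr[OF x] P2_def
    by (simp add: prob_space.prob_space_distr)
  show "integral\<^sup>L (discrete_measure d m p x) f = (\<Sum>j\<in>{1..m}. p j * f (x j))"
    if "f \<in> borel_measurable (Rd d)"
    unfolding discrete_measure_eq_distr[OF x] integral_distr[OF xM that]
    by (subst lebesgue_integral_point_measure_finite) (use p in auto)
  show "AE z in discrete_measure d m p x. Q z"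
    if "{z \<in> space (Rd d). Q z} \<in> sets (Rd d)" "\<And>j. j \<in> {1..m} \<Longrightarrow> Q (x j)"
    using that xM unfolding discrete_measure_eq_distr[OF x]
    by (simp add: AE_distr_iff AE_point_measure)
qed

section \<open>Couplings, their integrability and near-optimal transport\<close>

lemma pair_measure_in_couplings:
  assumes "prob_space P" "prob_space Q"
  shows "P \<Otimes>\<^sub>M Q \<in> couplings P Q"
proof -
  interpret P: prob_space P by fact
  interpret Q: prob_space Q by fact
  have "distr (P \<Otimes>\<^sub>M Q) Q snd = Q"
  proof (rule measure_eqI)
    fix A assume "A \<in> sets (distr (P \<Otimes>\<^sub>M Q) Q snd)"
    then have A: "A \<in> sets Q" by simp
    then have "snd -` A \<inter> space (P \<Otimes>\<^sub>M Q) = space P \<times> A"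
      using sets.sets_into_space by (auto simp: space_pair_measure)
    then show "emeasure (distr (P \<Otimes>\<^sub>M Q) Q snd) A = emeasure Q A"
      using A by (simp add: emeasure_distr Q.emeasure_pair_measure_Times P.emeasure_space_1)
  qed simp
  then show ?thesis
    using assms by (simp add: couplings_def prob_space_pair Q.distr_pair_fst)
qed

lemma coupling_measurable:
  assumes "\<pi> \<in> couplings P Q" "sets P = sets (Rd d)" "sets Q = sets (Rd d)"
  shows "fst \<in> measurable \<pi> (Rd d)" "snd \<in> measurable \<pi> (Rd d)"
    "fst \<in> measurable \<pi> P" "snd \<in> measurable \<pi> Q"
proof -
  have "sets \<pi> = sets (P \<Otimes>\<^sub>M Q)"
    using assms(1) by (simp add: couplings_def)
  then have "sets \<pi> = sets (P \<Otimes>\<^sub>M Q)" "sets \<pi> = sets (Rd d \<Otimes>\<^sub>M Rd d)"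
    using assms(2,3) sets_pair_measure_cong[OF assms(2,3)] by auto
  then show "fst \<in> measurable \<pi> (Rd d)" "snd \<in> measurable \<pi> (Rd d)"
    "fst \<in> measurable \<pi> P" "snd \<in> measurable \<pi> Q"
    by (metis measurable_cong_sets measurable_fst measurable_snd)+
qed

lemma integrable_L2_set_coupling:
  assumes "\<pi> \<in> couplings P Q" "P \<in> P2 d" "Q \<in> P2 d"
  shows "integrable \<pi> (\<lambda>z. (L2_set (fst z) {1..d})\<^sup>2)" "integrable \<pi> (\<lambda>z. (L2_set (snd z) {1..d})\<^sup>2)"
proof -
  have s: "sets P = sets (Rd d)" "sets Q = sets (Rd d)"
    using assms by (auto simp: P2_def)
  have "integrable (distr \<pi> P fst) (\<lambda>x. (L2_set x {1..d})\<^sup>2)"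
    "integrable (distr \<pi> Q snd) (\<lambda>x. (L2_set x {1..d})\<^sup>2)"
    using assms by (auto simp: couplings_def P2_def)
  then show "integrable \<pi> (\<lambda>z. (L2_set (fst z) {1..d})\<^sup>2)" "integrable \<pi> (\<lambda>z. (L2_set (snd z) {1..d})\<^sup>2)"
    using coupling_measurable[OF assms(1) s] integrable_distr by blast+
qed

lemma integrable_coupling_cost:
  assumes "\<pi> \<in> couplings P Q" "P \<in> P2 d" "Q \<in> P2 d"
  shows "integrable \<pi> (\<lambda>z. (edist d (fst z) (snd z))\<^sup>2)"
proof -
  have s: "sets P = sets (Rd d)" "sets Q = sets (Rd d)"
    using assms by (auto simp: P2_def)
  note [measurable] = coupling_measurable(1,2)[OF assms(1) s]
  show ?thesis
  proof (rule Bochner_Integration.integrable_bound)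
    show "integrable \<pi> (\<lambda>z. 2 * (L2_set (fst z) {1..d})\<^sup>2 + 2 * (L2_set (snd z) {1..d})\<^sup>2)"
      using integrable_L2_set_coupling[OF assms] by auto
    show "AE z in \<pi>. norm ((edist d (fst z) (snd z))\<^sup>2)
        \<le> norm (2 * (L2_set (fst z) {1..d})\<^sup>2 + 2 * (L2_set (snd z) {1..d})\<^sup>2)"
      using edist_square_le by (auto intro!: AE_I2)
  qed measurable
qed

text \<open>Working up to \<open>e\<close> avoids proving that an optimal coupling exists. The
  product coupling has finite cost, so the infimum is finite and its conversion to
  \<open>real\<close> loses nothing.\<close>

lemma W2_near_optimal_coupling:
  assumes "P \<in> P2 d" "Q \<in> P2 d" "e > 0"
  shows "\<exists>\<pi>\<in>couplings P Q. (\<integral>z. (edist d (fst z) (snd z))\<^sup>2 \<partial>\<pi>) < (W2 d P Q)\<^sup>2 + e"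
proof -
  let ?c = "\<lambda>\<pi>. \<integral>\<^sup>+ z. ennreal ((edist d (fst z) (snd z))\<^sup>2) \<partial>\<pi>"
  let ?I = "INF \<pi>\<in>couplings P Q. ?c \<pi>"
  have c: "?c \<pi> = ennreal (\<integral>z. (edist d (fst z) (snd z))\<^sup>2 \<partial>\<pi>)" if "\<pi> \<in> couplings P Q" for \<pi>
    using integrable_coupling_cost[OF that assms(1,2)] by (intro nn_integral_eq_integral) auto
  have prod: "P \<Otimes>\<^sub>M Q \<in> couplings P Q"
    using assms by (intro pair_measure_in_couplings) (auto simp: P2_def)
  have "?I \<le> ?c (P \<Otimes>\<^sub>M Q)"
    using prod by (rule INF_lower)
  also have "\<dots> < top"
    using c[OF prod] by simp
  finally have fin: "?I < top" .
  have "ennreal ((W2 d P Q)\<^sup>2) = ?I"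
    unfolding W2_def using fin by (simp add: enn2real_nonneg)
  then have "?I < ennreal ((W2 d P Q)\<^sup>2 + e)"
    using assms(3) by (metis ennreal_lessI less_add_same_cancel1 add_nonneg_pos zero_le_power2)
  then obtain \<pi> where \<pi>: "\<pi> \<in> couplings P Q" "?c \<pi> < ennreal ((W2 d P Q)\<^sup>2 + e)"
    unfolding INF_less_iff by blast
  then show ?thesis
    using c[OF \<pi>(1)] by (auto simp: ennreal_less_iff integral_nonneg)
qed

text \<open>The easy half of Kantorovich duality: integrate the pointwise bound against a
  near-optimal coupling and evaluate each term by its marginal.\<close>

lemma discrete_potential_le_W2:
  assumes x: "x ` {1..m} \<subseteq> space (Rd d)" "inj_on x {1..m}"
    and p: "\<And>j. j \<in> {1..m} \<Longrightarrow> p j \<ge> 0" "(\<Sum>j\<in>{1..m}. p j) = 1"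
    and P: "P \<in> P2 d" and \<phi>: "integrable P \<phi>" and "L \<ge> 0"
    and le: "\<And>j w. j \<in> {1..m} \<Longrightarrow> g j \<le> \<phi> w + L * (edist d (x j) w)\<^sup>2"
  shows "(\<Sum>j\<in>{1..m}. p j * g j) \<le> (\<integral>w. \<phi> w \<partial>P) + L * (W2 d P (discrete_measure d m p x))\<^sup>2"
proof -
  let ?Q = "discrete_measure d m p x"
  have Q: "?Q \<in> P2 d"
    by (rule discrete_measure_in_P2[OF x(1) p])
  have s: "sets P = sets (Rd d)" "sets ?Q = sets (Rd d)"
    using P Q by (auto simp: P2_def)
  \<comment> \<open>A point of \<open>Rd d\<close> is extensional, so its singleton is a finite box
    of singletons.\<close>
  have atom [measurable]: "{x j} \<in> sets (Rd d)" if "j \<in> {1..m}" for j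
  proof -
    have "{x j} = (\<Pi>\<^sub>E c\<in>{1..d}. {x j c})"
      using x(1) that by (intro PiE_singleton[symmetric]) (auto simp: space_Rd PiE_def)
    also have "\<dots> \<in> sets (Rd d)"
      unfolding Rd_def by (rule sets_PiM_I_finite) auto
    finally show ?thesis .
  qed
  \<comment> \<open>\<open>G\<close> extends \<open>g\<close> from indices to points, with value 0
    off the atoms. By injectivity of \<open>x\<close>, only one summand survives at each
    atom.\<close>
  define G where "G z = (\<Sum>j\<in>{1..m}. g j * indicator {x j} z)" for z
  have Gx: "G (x j) = g j" if "j \<in> {1..m}" for j
  proof -
    have "x j = x i \<longleftrightarrow> j = i" if "i \<in> {1..m}" for i
      using inj_on_eq_iff[OF x(2) \<open>j \<in> {1..m}\<close> that] .
    then have "G (x j) = (\<Sum>i\<in>{1..m}. if j = i then g i else 0)"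
      unfolding G_def by (intro sum.cong) (simp_all add: indicator_def)
    then show ?thesis using that by simp
  qed
  have G [measurable]: "G \<in> borel_measurable (Rd d)"
    unfolding G_def by measurable
  have atoms: "AE z in ?Q. z \<in> x ` {1..m}"
  proof (rule AE_discrete_measure[OF x(1) p])
    have "{z \<in> space (Rd d). z \<in> x ` {1..m}} = (\<Union>j\<in>{1..m}. {x j})"
      using x(1) by auto
    also have "\<dots> \<in> sets (Rd d)"
      using atom by (intro sets.finite_UN) auto
    finally show "{z \<in> space (Rd d). z \<in> x ` {1..m}} \<in> sets (Rd d)" .
  qed auto
  have approx: "(\<Sum>j\<in>{1..m}. p j * g j) \<le> (\<integral>w. \<phi> w \<partial>P) + L * ((W2 d P ?Q)\<^sup>2 + e)" if "e > 0" for e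
  proof -
    obtain \<pi> where \<pi>: "\<pi> \<in> couplings P ?Q"
      and less: "(\<integral>z. (edist d (fst z) (snd z))\<^sup>2 \<partial>\<pi>) < (W2 d P ?Q)\<^sup>2 + e"
      using W2_near_optimal_coupling[OF P Q \<open>e > 0\<close>] by blast
    note meas = coupling_measurable[OF \<pi> s]
    note [measurable] = meas(1,2)
    have d: "distr \<pi> P fst = P" "distr \<pi> ?Q snd = ?Q" and prob: "prob_space \<pi>"
      using \<pi> by (auto simp: couplings_def)
    interpret prob_space \<pi> by fact
    have GQ: "G \<in> borel_measurable ?Q"
      using G s(2) by (simp cong: measurable_cong_sets)
    have "(\<Sum>j\<in>{1..m}. p j * g j) = (\<integral>z. G z \<partial>?Q)"
      using integral_discrete_measure[OF x(1) p G] Gx by simp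
    also have "\<dots> = (\<integral>z. G (snd z) \<partial>\<pi>)"
      using integral_distr[OF meas(4) GQ] d by simp
    \<comment> \<open>The bound on \<open>G\<close> is known only at atoms, hence the comparison
      almost everywhere: the second marginal of \<open>\<pi>\<close> is concentrated on
      them.\<close>
    also have "\<dots> \<le> (\<integral>z. \<phi> (fst z) + L * (edist d (fst z) (snd z))\<^sup>2 \<partial>\<pi>)"
    proof (rule integral_mono_AE)
      show "integrable \<pi> (\<lambda>z. G (snd z))"
      proof (rule integrable_const_bound)
        have "\<bar>G z\<bar> \<le> (\<Sum>j\<in>{1..m}. \<bar>g j\<bar>)" for z
          unfolding G_def by (rule order_trans[OF sum_abs sum_mono]) (auto simp: indicator_def)
        then show "AE z in \<pi>. norm (G (snd z)) \<le> (\<Sum>j\<in>{1..m}. \<bar>g j\<bar>)"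
          by simp
      qed measurable
      show "integrable \<pi> (\<lambda>z. \<phi> (fst z) + L * (edist d (fst z) (snd z))\<^sup>2)"
        using integrable_distr[OF meas(3), of \<phi>] \<phi> d integrable_coupling_cost[OF \<pi> P Q] by auto
      have "AE z in \<pi>. snd z \<in> x ` {1..m}"
        using AE_distrD[OF meas(4), of "\<lambda>z. z \<in> x ` {1..m}"] atoms unfolding d(2) by blast
      then show "AE z in \<pi>. G (snd z) \<le> \<phi> (fst z) + L * (edist d (fst z) (snd z))\<^sup>2"
      proof eventually_elim
        case (elim z)
        then obtain j where j: "j \<in> {1..m}" "snd z = x j" by auto
        have "edist d (fst z) (snd z) ^ 2 = edist d (snd z) (fst z) ^ 2"
          unfolding edist_square by (simp add: power2_commute)
        then show ?case
          using j le[OF j(1), of "fst z"] Gx by simp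
      qed
    qed
    also have "\<dots> = (\<integral>w. \<phi> w \<partial>P) + L * (\<integral>z. (edist d (fst z) (snd z))\<^sup>2 \<partial>\<pi>)"
      using integrable_distr[OF meas(3), of \<phi>] integral_distr[OF meas(3), of \<phi>] \<phi> d
        integrable_coupling_cost[OF \<pi> P Q] by simp
    also have "\<dots> \<le> (\<integral>w. \<phi> w \<partial>P) + L * ((W2 d P ?Q)\<^sup>2 + e)"
      using less \<open>L \<ge> 0\<close> by (intro add_left_mono mult_left_mono) auto
    finally show ?thesis .
  qed
  show ?thesis
  proof (rule field_le_epsilon)
    fix e :: real assume "e > 0"
    \<comment> \<open>Dividing by \<open>L + 1\<close> instead of \<open>L\<close> also covers
      \<open>L = 0\<close>.\<close>
    then have "e / (L + 1) > 0" and "L * (e / (L + 1)) \<le> e"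
      using \<open>L \<ge> 0\<close> by (auto simp: field_simps)
    then show "(\<Sum>j\<in>{1..m}. p j * g j) \<le> (\<integral>w. \<phi> w \<partial>P) + L * (W2 d P ?Q)\<^sup>2 + e"
      using approx[of "e / (L + 1)"] by (simp add: algebra_simps)
  qed
qed

subsection \<open>Weak duality\<close>

text \<open>Potentials in the single variable \<open>w\<close> decouple the marginals: each is
  tested against its own coupling with \<open>P\<close>, and only their pointwise sum has to be
  controlled.\<close>

lemma dual_feasible_le_barycenter_cost:
  assumes m: "\<And>i. i \<in> {1..k} \<Longrightarrow> m i \<ge> (1::nat)"
    and x: "\<And>i. i \<in> {1..k} \<Longrightarrow> x i ` {1..m i} \<subseteq> space (Rd d) \<and> inj_on (x i) {1..m i}"
    and p: "\<And>i j. i \<in> {1..k} \<Longrightarrow> j \<in> {1..m i} \<Longrightarrow> p i j \<ge> 0"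
      "\<And>i. i \<in> {1..k} \<Longrightarrow> (\<Sum>j\<in>{1..m i}. p i j) = 1"
    and l: "\<And>i. i \<in> {1..k} \<Longrightarrow> l i \<ge> 0" and "K \<ge> 0" and P: "P \<in> P2 d"
    and feasible: "\<And>j w. j \<in> (\<Pi>\<^sub>E i\<in>{1..k}. {1..m i}) \<Longrightarrow>
      (\<Sum>i\<in>{1..k}. \<gamma> i (j i)) \<le> K * (\<Sum>i\<in>{1..k}. l i * (edist d (x i (j i)) w)\<^sup>2)"
  shows "(\<Sum>i\<in>{1..k}. \<Sum>j\<in>{1..m i}. p i j * \<gamma> i j)
    \<le> K * (\<Sum>i\<in>{1..k}. l i * (W2 d P (discrete_measure d (m i) (p i) (x i)))\<^sup>2)"
proof -
  define f where "f i j w = \<gamma> i j - K * l i * (edist d (x i j) w)\<^sup>2" for i j w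
  define \<phi> where "\<phi> i w = Max ((\<lambda>j. f i j w) ` {1..m i})" for i w
  interpret P: prob_space P
    using P by (simp add: P2_def)
  have sP [measurable_cong]: "sets P = sets (Rd d)"
    using P by (simp add: P2_def)
  have f_le: "f i j w \<le> \<phi> i w" if "j \<in> {1..m i}" for i j w
    unfolding \<phi>_def using that by (intro Max_ge) auto
  have attained: "\<exists>j\<in>{1..m i}. \<phi> i w = f i j w" if "i \<in> {1..k}" for i w
  proof -
    have "\<phi> i w \<in> (\<lambda>j. f i j w) ` {1..m i}"
      unfolding \<phi>_def using m[OF that] by (intro Max_in) auto
    then show ?thesis by blast
  qed
  have integrable: "integrable P (\<phi> i)" if i: "i \<in> {1..k}" for i
  proof -
    have x': "x i j \<in> space (Rd d)" if "j \<in> {1..m i}" for j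
      using x[OF i] that by auto
    have f_meas: "f i j \<in> borel_measurable P" if "j \<in> {1..m i}" for j
    proof -
      have [measurable]: "(\<lambda>w. x i j) \<in> measurable P (Rd d)" "(\<lambda>w. w) \<in> measurable P (Rd d)"
        using x'[OF that] by auto
      show ?thesis unfolding f_def by measurable
    qed
    \<comment> \<open>\<open>f i j\<close> grows at most quadratically, and \<open>P\<close> has a
      finite second moment.\<close>
    have f_int: "integrable P (f i j)" if j: "j \<in> {1..m i}" for j
    proof (rule Bochner_Integration.integrable_bound)
      show "integrable P (\<lambda>w. \<bar>\<gamma> i j\<bar> + K * l i * (2 * (L2_set (x i j) {1..d})\<^sup>2 + 2 * (L2_set w {1..d})\<^sup>2))"
        using P by (auto simp: P2_def)
      show "AE w in P. norm (f i j w) \<le> norm (\<bar>\<gamma> i j\<bar> + K * l i * (2 * (L2_set (x i j) {1..d})\<^sup>2 + 2 * (L2_set w {1..d})\<^sup>2))"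
      proof (rule AE_I2)
        fix w
        have "0 \<le> K * l i * (edist d (x i j) w)\<^sup>2"
          "K * l i * (edist d (x i j) w)\<^sup>2
            \<le> K * l i * (2 * (L2_set (x i j) {1..d})\<^sup>2 + 2 * (L2_set w {1..d})\<^sup>2)"
          using \<open>K \<ge> 0\<close> l[OF i] edist_square_le by (auto intro!: mult_left_mono)
        then show "norm (f i j w) \<le> norm (\<bar>\<gamma> i j\<bar> + K * l i * (2 * (L2_set (x i j) {1..d})\<^sup>2 + 2 * (L2_set w {1..d})\<^sup>2))"
          unfolding f_def real_norm_def by linarith
      qed
    qed (rule f_meas[OF j])
    show ?thesis
    proof (rule Bochner_Integration.integrable_bound)
      show "integrable P (\<lambda>w. \<Sum>j\<in>{1..m i}. \<bar>f i j w\<bar>)"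
        using f_int by auto
      show "\<phi> i \<in> borel_measurable P"
        unfolding \<phi>_def using f_meas by (intro borel_measurable_Max) auto
      show "AE w in P. norm (\<phi> i w) \<le> norm (\<Sum>j\<in>{1..m i}. \<bar>f i j w\<bar>)"
      proof (rule AE_I2)
        fix w
        obtain j where j: "j \<in> {1..m i}" "\<phi> i w = f i j w"
          using attained[OF i] by blast
        then have "\<bar>f i j w\<bar> \<le> (\<Sum>j\<in>{1..m i}. \<bar>f i j w\<bar>)"
          by (intro member_le_sum) auto
        then show "norm (\<phi> i w) \<le> norm (\<Sum>j\<in>{1..m i}. \<bar>f i j w\<bar>)"
          using j by simp
      qed
    qed
  qed
  have sum_\<phi>: "(\<Sum>i\<in>{1..k}. \<phi> i w) \<le> 0" for w
  proof -
    \<comment> \<open>Maximising indices chosen separately for each \<open>i\<close> form one tuple.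
      Its dual constraint at the same \<open>w\<close> bounds the sum of the potentials.\<close>
    obtain J where J: "\<forall>i\<in>{1..k}. J i \<in> {1..m i} \<and> \<phi> i w = f i (J i) w"
      using bchoice[of "{1..k}" "\<lambda>i j. j \<in> {1..m i} \<and> \<phi> i w = f i j w"] attained by blast
    have "(\<Sum>i\<in>{1..k}. \<gamma> i (J i)) \<le> K * (\<Sum>i\<in>{1..k}. l i * (edist d (x i (J i)) w)\<^sup>2)"
      \<comment> \<open>Restriction makes the choice function an element of the extensional
        product.\<close>
      using feasible[of "restrict J {1..k}" w] J by simp
    moreover have "(\<Sum>i\<in>{1..k}. \<phi> i w)
        = (\<Sum>i\<in>{1..k}. \<gamma> i (J i)) - K * (\<Sum>i\<in>{1..k}. l i * (edist d (x i (J i)) w)\<^sup>2)"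
      using J by (simp add: f_def sum_subtractf sum_distrib_left mult.assoc)
    ultimately show ?thesis by simp
  qed
  have "(\<Sum>i\<in>{1..k}. \<Sum>j\<in>{1..m i}. p i j * \<gamma> i j)
      \<le> (\<Sum>i\<in>{1..k}. (\<integral>w. \<phi> i w \<partial>P) + K * l i * (W2 d P (discrete_measure d (m i) (p i) (x i)))\<^sup>2)"
  proof (rule sum_mono)
    fix i assume i: "i \<in> {1..k}"
    show "(\<Sum>j\<in>{1..m i}. p i j * \<gamma> i j)
        \<le> (\<integral>w. \<phi> i w \<partial>P) + K * l i * (W2 d P (discrete_measure d (m i) (p i) (x i)))\<^sup>2"
    proof (rule discrete_potential_le_W2)
      show "\<gamma> i j \<le> \<phi> i w + K * l i * (edist d (x i j) w)\<^sup>2" if "j \<in> {1..m i}" for j w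
        using f_le[OF that, of w] by (simp add: f_def)
    qed (use i x p l P integrable \<open>K \<ge> 0\<close> in auto)
  qed
  also have "\<dots> = (\<integral>w. (\<Sum>i\<in>{1..k}. \<phi> i w) \<partial>P)
      + K * (\<Sum>i\<in>{1..k}. l i * (W2 d P (discrete_measure d (m i) (p i) (x i)))\<^sup>2)"
    using integrable by (simp add: sum.distrib sum_distrib_left mult.assoc)
  also have "(\<integral>w. (\<Sum>i\<in>{1..k}. \<phi> i w) \<partial>P) \<le> (\<integral>w. 0 \<partial>P)"
    using integrable sum_\<phi> by (intro integral_mono) auto
  finally show ?thesis by simp
qed

section \<open>The approximation factor and the size bound together\<close>

theorem theorem3:
  fixes t :: nat
  assumes "t \<ge> 1"
  shows "\<exists>C::real. \<forall>(d::nat) (k::nat) (n::nat) (m :: nat \<Rightarrow> nat)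
            (x :: nat \<Rightarrow> nat \<Rightarrow> nat \<Rightarrow> real) (p :: nat \<Rightarrow> nat \<Rightarrow> real) (l :: nat \<Rightarrow> real)
            (\<Xi> :: nat \<Rightarrow> (nat \<Rightarrow> real) set) (S :: (nat \<Rightarrow> real) set).
          t \<in> {1..k} \<longrightarrow>
          (\<forall>i\<in>{1..k}. 1 \<le> m i \<and> m i \<le> n) \<longrightarrow>
          (\<forall>i\<in>{1..k}. x i ` {1..m i} \<subseteq> space (Rd d) \<and> inj_on (x i) {1..m i}) \<longrightarrow>
          (\<forall>i\<in>{1..k}. \<Xi> i = x i ` {1..m i}) \<longrightarrow>
          (\<forall>i\<in>{1..k}. (\<forall>j\<in>{1..m i}. p i j \<ge> 0) \<and> (\<Sum>j\<in>{1..m i}. p i j) = 1) \<longrightarrow>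
          (\<forall>i\<in>{1..k}. l i \<ge> 0) \<longrightarrow> (\<Sum>i\<in>{1..k}. l i) = 1 \<longrightarrow>
          S = support_average_set t d k \<Xi> \<longrightarrow>
            dual_value d k m x p l S \<le> (1 + 1 / real t) * barycenter_value d k m x p l
            \<and> finite S \<and> real (card S) \<le> C * (real n * real k) ^ t"
proof (intro exI[of _ 1] allI impI)
  fix d k n :: nat and m :: "nat \<Rightarrow> nat" and x :: "nat \<Rightarrow> nat \<Rightarrow> nat \<Rightarrow> real"
    and p :: "nat \<Rightarrow> nat \<Rightarrow> real" and l :: "nat \<Rightarrow> real"
    and \<Xi> :: "nat \<Rightarrow> (nat \<Rightarrow> real) set" and S :: "(nat \<Rightarrow> real) set"
  assume t: "t \<in> {1..k}"
    and m: "\<forall>i\<in>{1..k}. 1 \<le> m i \<and> m i \<le> n"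
    and x: "\<forall>i\<in>{1..k}. x i ` {1..m i} \<subseteq> space (Rd d) \<and> inj_on (x i) {1..m i}"
    and \<Xi>: "\<forall>i\<in>{1..k}. \<Xi> i = x i ` {1..m i}"
    and p: "\<forall>i\<in>{1..k}. (\<forall>j\<in>{1..m i}. p i j \<ge> 0) \<and> (\<Sum>j\<in>{1..m i}. p i j) = 1"
    and l: "\<forall>i\<in>{1..k}. l i \<ge> 0" "(\<Sum>i\<in>{1..k}. l i) = 1"
    and S: "S = support_average_set t d k \<Xi>"
  have "finite (\<Xi> i) \<and> card (\<Xi> i) \<le> n" if "i \<in> {1..k}" for i
    using that m \<Xi> x by (auto simp: card_image)
  then have fin: "finite S" and card: "card S \<le> (n * k) ^ t"
    using support_average_set_finite_card unfolding S by blast+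
  have "x 1 1 \<in> \<Xi> 1"
    using t m \<Xi> by auto
  \<comment> \<open>Averaging points of the first support gives an element, so \<open>Min\<close> in
    the tensor cost ranges over a nonempty finite set.\<close>
  then have "S \<noteq> {}"
    unfolding S support_average_set_def using t by fastforce
  let ?K = "1 + 1 / real t"
  let ?B = "\<lambda>P. \<Sum>i\<in>{1..k}. l i * (W2 d P (discrete_measure d (m i) (p i) (x i)))\<^sup>2"
  let ?A = "{(\<Sum>i\<in>{1..k}. \<Sum>j\<in>{1..m i}. p i j * \<gamma> i j) | \<gamma>.
      \<forall>j \<in> (\<Pi>\<^sub>E i\<in>{1..k}. {1..m i}). tensor_cost d k x l S j - (\<Sum>i\<in>{1..k}. \<gamma> i (j i)) \<ge> 0}"
  have "discrete_measure d (m 1) (p 1) (x 1) \<in> P2 d"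
    using t x p by (intro discrete_measure_in_P2) auto
  then have P2: "P2 d \<noteq> {}" by blast
  have "tensor_cost d k x l S j \<ge> 0" for j
    unfolding tensor_cost_def using fin \<open>S \<noteq> {}\<close> l(1) by (auto intro!: sum_nonneg)
  \<comment> \<open>Costs are nonnegative, so the zero potential is feasible and the supremum is
    over a nonempty set.\<close>
  then have "?A \<noteq> {}"
    by (auto intro!: exI[of _ "\<lambda>_ _. 0"])
  moreover have "a \<le> ?K * barycenter_value d k m x p l" if "a \<in> ?A" for a
  proof -
    obtain \<gamma> where a: "a = (\<Sum>i\<in>{1..k}. \<Sum>j\<in>{1..m i}. p i j * \<gamma> i j)"
      and \<gamma>: "\<And>j. j \<in> (\<Pi>\<^sub>E i\<in>{1..k}. {1..m i}) \<Longrightarrow> (\<Sum>i\<in>{1..k}. \<gamma> i (j i)) \<le> tensor_cost d k x l S j"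
      using \<open>a \<in> ?A\<close> unfolding mem_Collect_eq diff_ge_0_iff_ge by blast
    have "(\<Sum>i\<in>{1..k}. \<gamma> i (j i)) \<le> ?K * (\<Sum>i\<in>{1..k}. l i * (edist d (x i (j i)) w)\<^sup>2)"
      if "j \<in> (\<Pi>\<^sub>E i\<in>{1..k}. {1..m i})" for j w
    proof -
      have "x i (j i) \<in> \<Xi> i" if "i \<in> {1..k}" for i
        using \<Xi> that \<open>j \<in> _\<close> by auto
      then have "tensor_cost d k x l S j \<le> ?K * (\<Sum>i\<in>{1..k}. l i * (edist d (x i (j i)) w)\<^sup>2)"
        unfolding S using l fin S assms by (intro tensor_cost_support_average_le) auto
      then show ?thesis
        using \<gamma>[OF that] by simp
    qed
    then have "a \<le> ?K * ?B P" if "P \<in> P2 d" for P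
      unfolding a using m x p l that by (intro dual_feasible_le_barycenter_cost) auto
    \<comment> \<open>Dividing by the positive factor isolates a lower bound valid for every
      competitor \<open>P\<close>, which then passes to the infimum.\<close>
    then have "a / ?K \<le> ?B P" if "P \<in> P2 d" for P
      using that assms by (simp add: divide_le_eq add_pos_nonneg mult.commute)
    then have "a / ?K \<le> barycenter_value d k m x p l"
      unfolding barycenter_value_def using P2 by (intro cINF_greatest) auto
    then show ?thesis
      using assms by (simp add: divide_le_eq add_pos_nonneg mult.commute)
  qed
  ultimately have "dual_value d k m x p l S \<le> ?K * barycenter_value d k m x p l"
    unfolding dual_value_def by (intro cSup_least) auto
  \<comment> \<open>The count holds with constant 1, independently of \<open>t\<close>.\<close>
  moreover have "real (card S) \<le> 1 * (real n * real k) ^ t"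
    using card by (metis mult_1 of_nat_le_iff of_nat_mult of_nat_power)
  ultimately show "dual_value d k m x p l S \<le> ?K * barycenter_value d k m x p l
      \<and> finite S \<and> real (card S) \<le> 1 * (real n * real k) ^ t"
    using fin by blast
qed

end
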